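(* Let $\{g_{ij}^*\}_{(i,j)\in\mathcal{E}}$ be feasible bearing constraints that ensure infinitesimal bearing rigidity. Let $p(0)\in\mathbb{R}^{dn}$ be an initial configuration with $p_i(0)\ne p_j(0)$ for all $(i,j)\in\mathcal{E}$, let $p^*$ be the associated target configuration, $r^*=p^*-\mathbf{1}\otimes\bar p^*$, and let $p(t)$, $t\ge 0$, be a solution of $$\dot p_i(t)=-\sum_{j\in\mathcal{N}_i}P_{g_{ij}(t)}g_{ij}^*,\qquad i\in\mathcal{V},$$ along which no two neighboring agents collide. Then $\delta(t)=p(t)-p^*$ converges to $0$ exponentially fast (i.e. there are constants $C,K>0$, possibly depending on $p(0)$, with $\|\delta(t)\|\le Ce^{-Kt}$ for all $t\ge0$) whenever $\delta(0)\ne-2r^*$.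
   Context: Let $n\ge2$, $d\ge 2$, and let $\mathcal{G}=(\mathcal{V},\mathcal{E})$ be a fixed undirected graph without self-loops, $\mathcal{V}=\{1,\dots,n\}$, with $m$ edges, neighbor sets $\mathcal{N}_i$. Agent $i$ has position $p_i\in\mathbb{R}^d$, $p=[p_1^{\mathrm T},\dots,p_n^{\mathrm T}]^{\mathrm T}$. For $(i,j)\in\mathcal{E}$, $e_{ij}=p_j-p_i$ and $g_{ij}=e_{ij}/\|e_{ij}\|$ (the bearing, defined when $p_i\neq p_j$). For nonzero $x\in\mathbb{R}^d$, $P_x=I_d-xx^{\mathrm T}/\|x\|^2$. $\mathbf 1=[1,\dots,1]^{\mathrm T}\in\mathbb{R}^n$. Bearing constraints are constant unit vectors $g_{ij}^*\in\mathbb{R}^d$, $(i,j)\in\mathcal{E}$, with $g_{ij}^*=-g_{ji}^*$. They are feasible if some configuration satisfies $g_{ij}=g_{ij}^*$ for all $(i,j)\in\mathcal{E}$. They ensure infinitesimal bearing rigidity if any formation $\mathcal{G}(q)$ satisfying them is infinitesimally bearing rigid, meaning: with $R(q)$ the Jacobian with respect to $q$ of the stacked bearing vector $[g_1^{\mathrm T},\dots,g_m^{\mathrm T}]^{\mathrm T}$ (one bearing per edge for an arbitrary orientation), every $\delta q$ with $R(q)\delta q=0$ has the form $\mathbf{1}\otimes x+\alpha q$, $x\in\mathbb{R}^d$, $\alpha\in\mathbb{R}$. The centroid and scale of $p$ are $\bar p=\frac1n\sum_i p_i$ and $s=\sqrt{\frac1n\sum_i\|p_i-\bar p\|^2}$.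 The target configuration $p^*$ associated with $p(0)$ is the unique configuration with centroid $\bar p^*=\bar p(0)$, scale $s^*=s(0)$, and $(p_j^*-p_i^* )/\|p_j^*-p_i^*\|=g_{ij}^*$ for all $(i,j)\in\mathcal{E}$. (The vector $\delta$ then lies on the sphere $\mathcal{S}=\{\delta\in\mathbb{R}^{dn}:\|\delta+r^*\|=\|r^*\|\}$.) *)

theory Defs
  imports "HOL-Analysis.Analysis"
begin

text \<open>
  Agents are the elements of a finite type \<open>'n\<close>, so a configuration in \<open>R^(dn)\<close> is a term of
  type \<open>real^'d^'n\<close>, whose norm is the Euclidean norm of the stacked vector, and the Kronecker
  product of the all-ones vector with \<open>x\<close> is \<open>vec x\<close>. An undirected graph without self-loops is a
  symmetric irreflexive relation \<open>E\<close>; each undirected edge occurs in it as two ordered pairs.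
\<close>

type_synonym ('d, 'n) config = "real^'d^'n"

definition undirected_graph :: "('n \<times> 'n) set \<Rightarrow> bool" where
  "undirected_graph E \<longleftrightarrow> sym E \<and> irrefl E"

definition neighbors :: "('n \<times> 'n) set \<Rightarrow> 'n \<Rightarrow> 'n set" where
  "neighbors E i = {j. (i, j) \<in> E}"

definition noncolliding :: "('n \<times> 'n) set \<Rightarrow> ('d::finite, 'n::finite) config \<Rightarrow> bool" where
  "noncolliding E p \<longleftrightarrow> (\<forall>(i, j) \<in> E. p $ i \<noteq> p $ j)"

definition bearing :: "('d::finite, 'n::finite) config \<Rightarrow> 'n \<Rightarrow> 'n \<Rightarrow> real^'d" where
  "bearing p i j = (p $ j - p $ i) /\<^sub>R norm (p $ j - p $ i)"

definition orth_proj :: "real^'d \<Rightarrow> real^'d^'d::finite" where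
  "orth_proj x = mat 1 - (\<chi> k l. x $ k * x $ l) /\<^sub>R (norm x)\<^sup>2"

definition orientation :: "('n \<times> 'n) set \<Rightarrow> ('n \<times> 'n) set \<Rightarrow> bool" where
  "orientation E A \<longleftrightarrow> A \<union> converse A = E \<and> A \<inter> converse A = {}"

text \<open>
  The stacked bearing vector has one block for each oriented edge in \<open>A\<close>; the blocks of the
  remaining pairs are padded with zeros, which does not affect the kernel of the Jacobian.
\<close>

definition stacked_bearing ::
    "('n \<times> 'n) set \<Rightarrow> ('d::finite, 'n::finite) config \<Rightarrow> real^'d^('n \<times> 'n)" where
  "stacked_bearing A p = (\<chi> e. if e \<in> A then bearing p (fst e) (snd e) else 0)"

text \<open>
  Reversing an edge only changes the sign of its block, so the kernel is the same for every
  orientation.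
\<close>

definition infinitesimally_bearing_rigid ::
    "('n \<times> 'n) set \<Rightarrow> ('d::finite, 'n::finite) config \<Rightarrow> bool" where
  "infinitesimally_bearing_rigid E q \<longleftrightarrow>
     (\<exists>A. orientation E A \<and>
       (\<forall>dq. frechet_derivative (stacked_bearing A) (at q) dq = 0 \<longrightarrow>
         (\<exists>x \<alpha>. dq = vec x + \<alpha> *\<^sub>R q)))"

definition bearing_constraints ::
    "('n \<times> 'n) set \<Rightarrow> ('n \<Rightarrow> 'n \<Rightarrow> real^'d::finite) \<Rightarrow> bool" where
  "bearing_constraints E gs \<longleftrightarrow> (\<forall>(i, j) \<in> E. norm (gs i j) = 1 \<and> gs i j = - gs j i)"

definition satisfies_constraints ::
    "('n \<times> 'n) set \<Rightarrow> ('n \<Rightarrow> 'n \<Rightarrow> real^'d) \<Rightarrow> ('d::finite, 'n::finite) config \<Rightarrow> bool" where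
  "satisfies_constraints E gs q \<longleftrightarrow>
     noncolliding E q \<and> (\<forall>(i, j) \<in> E. bearing q i j = gs i j)"

definition feasible ::
    "('n::finite \<times> 'n) set \<Rightarrow> ('n \<Rightarrow> 'n \<Rightarrow> real^'d::finite) \<Rightarrow> bool" where
  "feasible E gs \<longleftrightarrow> (\<exists>q. satisfies_constraints E gs q)"

definition ensures_rigidity ::
    "('n::finite \<times> 'n) set \<Rightarrow> ('n \<Rightarrow> 'n \<Rightarrow> real^'d::finite) \<Rightarrow> bool" where
  "ensures_rigidity E gs \<longleftrightarrow>
     (\<forall>q. satisfies_constraints E gs q \<longrightarrow> infinitesimally_bearing_rigid E q)"

definition centroid :: "('d::finite, 'n::finite) config \<Rightarrow> real^'d" where
  "centroid p = (\<Sum>i\<in>UNIV. p $ i) /\<^sub>R real CARD('n)"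

definition scale :: "('d::finite, 'n::finite) config \<Rightarrow> real" where
  "scale p = sqrt ((\<Sum>i\<in>UNIV. (norm (p $ i - centroid p))\<^sup>2) / real CARD('n))"

definition target_configuration ::
    "('n \<times> 'n) set \<Rightarrow> ('n \<Rightarrow> 'n \<Rightarrow> real^'d) \<Rightarrow> ('d::finite, 'n::finite) config
      \<Rightarrow> ('d, 'n) config \<Rightarrow> bool" where
  "target_configuration E gs p0 ps \<longleftrightarrow>
     centroid ps = centroid p0 \<and> scale ps = scale p0 \<and> satisfies_constraints E gs ps"

definition bearing_only_solution ::
    "('n \<times> 'n) set \<Rightarrow> ('n \<Rightarrow> 'n \<Rightarrow> real^'d) \<Rightarrow> (real \<Rightarrow> ('d::finite, 'n::finite) config)
      \<Rightarrow> bool" where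
  "bearing_only_solution E gs p \<longleftrightarrow>
     (\<forall>t\<ge>0. \<forall>i. ((\<lambda>\<tau>. p \<tau> $ i) has_vector_derivative
        - (\<Sum>j\<in>neighbors E i. orth_proj (bearing (p t) i j) *v gs i j)) (at t within {0..}))"

end

theory Submission
  imports Defs
begin

text \<open>
  The velocity field is orthogonal to translations and to \<open>p\<close> itself, so the centroid and the norm
  of \<open>p\<close> are conserved, and \<open>\<parallel>\<delta>\<parallel>\<^sup>2\<close> has derivative
  \<open>- (\<Sum>(i, j)\<in>E. \<parallel>p*\<^sub>j - p*\<^sub>i\<parallel> (1 - (g\<^sub>i\<^sub>j \<bullet> g*\<^sub>i\<^sub>j)\<^sup>2))\<close>, which is at most a negative multiple of
  \<open>\<parallel>L \<delta>\<parallel>\<^sup>2\<close>, where \<open>L\<close> collects the components of the edge vectors orthogonal to \<open>g*\<^sub>i\<^sub>j\<close>. By rigidity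
  the kernel of \<open>L\<close> is spanned by the translations and \<open>r*\<close>, so \<open>L\<close> is bounded below on the
  orthogonal complement. The component of \<open>\<delta>\<close> along \<open>r*\<close> is under control because \<open>\<delta>\<close> lies on the
  sphere \<open>S\<close>: the part of \<open>\<delta>\<close> orthogonal to \<open>r*\<close> has squared norm \<open>\<parallel>\<delta>\<parallel>\<^sup>2 (1 - \<parallel>\<delta>\<parallel>\<^sup>2 / (4 \<parallel>r*\<parallel>\<^sup>2))\<close>, and
  the last factor is bounded away from zero as \<open>\<parallel>\<delta>\<parallel>\<close> is nonincreasing and initially less than
  \<open>2 \<parallel>r*\<parallel>\<close>.
\<close>

section \<open>Algebra of orthogonal projections\<close>

lemma orth_proj_mult:
  fixes x y :: "real^'d::finite"
  shows "orth_proj x *v y = y - ((x \<bullet> y) / (norm x)\<^sup>2) *\<^sub>R x"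
proof -
  have "(\<chi> k l. x $ k * x $ l) *v y = (x \<bullet> y) *\<^sub>R x"
    by (simp add: vec_eq_iff matrix_vector_mult_def inner_vec_def sum_distrib_left mult_ac)
  then show ?thesis
    by (simp add: orth_proj_def matrix_vector_mult_diff_rdistrib scaleR_matrix_vector_assoc [symmetric]
        divide_inverse mult_ac)
qed

lemma orth_proj_mult_unit:
  assumes "norm x = 1"
  shows "orth_proj x *v y = y - (x \<bullet> y) *\<^sub>R x"
  using assms by (simp add: orth_proj_mult)

text \<open>This is the squared sine of the angle between \<open>u\<close> and \<open>v\<close>. Its
  symmetry in the two vectors later lets the projection along the current bearing be traded for one
  along the constraint.\<close>

lemma inner_orth_proj_unit:
  assumes "norm u = 1" "norm v = 1"
  shows "v \<bullet> (orth_proj u *v v) = 1 - (u \<bullet> v)\<^sup>2"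
  using assms by (simp add: orth_proj_mult_unit inner_diff_right power2_eq_square inner_commute
      dot_square_norm)

lemma norm_orth_proj_unit:
  assumes "norm v = 1"
  shows "(norm (orth_proj v *v y))\<^sup>2 = (norm y)\<^sup>2 - (v \<bullet> y)\<^sup>2"
proof -
  have "v \<bullet> v = 1" using assms by (simp add: dot_square_norm)
  then show ?thesis using assms
    by (simp add: orth_proj_mult_unit power2_norm_eq_inner inner_diff_left inner_diff_right)
       (simp add: power2_eq_square inner_commute)
qed

section \<open>Jacobian of the stacked bearing vector\<close>

text \<open>Product rule for \<open>f\<close> and the inverse of its norm. The result is the
  projection of \<open>f' h\<close> orthogonal to \<open>f x\<close>, divided by the length of
  \<open>f x\<close>.\<close>

lemma has_derivative_normalize:
  fixes f :: "'a::real_normed_vector \<Rightarrow> 'b::real_inner"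
  assumes "(f has_derivative f') (at x)" "f x \<noteq> 0"
  shows "((\<lambda>y. f y /\<^sub>R norm (f y)) has_derivative
    (\<lambda>h. (f' h - ((f x \<bullet> f' h) / (norm (f x))\<^sup>2) *\<^sub>R f x) /\<^sub>R norm (f x))) (at x)"
proof -
  have n: "((\<lambda>y. norm (f y)) has_derivative (\<lambda>h. f' h \<bullet> sgn (f x))) (at x)"
    using has_derivative_compose [OF assms(1) has_derivative_norm[OF assms(2)]] by (simp add: inner_commute)
  have i: "((\<lambda>y. inverse (norm (f y))) has_derivative
       (\<lambda>h. - (inverse (norm (f x)) * (f' h \<bullet> sgn (f x)) * inverse (norm (f x))))) (at x)"
    using Deriv.has_derivative_inverse[OF _ n] assms(2) by simp
  show ?thesis
    by (rule has_derivative_eq_rhs[OF has_derivative_scaleR[OF i assms(1)]])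
       (use assms(2) in \<open>auto simp: fun_eq_iff algebra_simps sgn_div_norm inner_commute power2_eq_square divide_inverse\<close>)
qed

lemma has_derivative_vec_lambda:
  fixes f :: "'n::finite \<Rightarrow> 'a::real_normed_vector \<Rightarrow> 'b::euclidean_space"
  assumes "\<And>i. (f i has_derivative f' i) (at x within S)"
  shows "((\<lambda>y. \<chi> i. f i y) has_derivative (\<lambda>h. \<chi> i. f' i h)) (at x within S)"
  unfolding has_derivative_componentwise_within[where 'b="'b^'n"]
  using assms by (auto simp: Basis_vec_def inner_axis intro!: has_derivative_inner_left)

lemma has_derivative_stacked_bearing:
  fixes q :: "('d::finite, 'n::finite) config"
  assumes "\<And>i j. (i, j) \<in> A \<Longrightarrow> q $ i \<noteq> q $ j"
  shows "(stacked_bearing A has_derivative (\<lambda>h. \<chi> e. if e \<in> A then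
    (orth_proj (q $ snd e - q $ fst e) *v (h $ snd e - h $ fst e)) /\<^sub>R norm (q $ snd e - q $ fst e) else 0)) (at q)"
proof -
  have "((\<lambda>p. stacked_bearing A p $ e) has_derivative (\<lambda>h. if e \<in> A then
    (orth_proj (q $ snd e - q $ fst e) *v (h $ snd e - h $ fst e)) /\<^sub>R norm (q $ snd e - q $ fst e) else 0)) (at q)" for e
  proof (cases "e \<in> A")
    case True
    have "((\<lambda>p::('d, 'n) config. p $ snd e - p $ fst e) has_derivative (\<lambda>h. h $ snd e - h $ fst e)) (at q)"
      by (intro bounded_linear.has_derivative[OF bounded_linear_vec_nth] has_derivative_diff has_derivative_ident)
    moreover have "q $ snd e - q $ fst e \<noteq> 0"
      using assms[of "fst e" "snd e"] True by auto
    ultimately show ?thesis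
      using True has_derivative_normalize[of "\<lambda>p. p $ snd e - p $ fst e"]
      by (simp add: stacked_bearing_def bearing_def orth_proj_mult)
  qed (simp add: stacked_bearing_def)
  then have "((\<lambda>p. \<chi> e. stacked_bearing A p $ e) has_derivative (\<lambda>h. \<chi> e. if e \<in> A then
    (orth_proj (q $ snd e - q $ fst e) *v (h $ snd e - h $ fst e)) /\<^sub>R norm (q $ snd e - q $ fst e) else 0)) (at q)"
    by (intro has_derivative_vec_lambda)
  then show ?thesis by simp
qed

section \<open>The projected edge map and its kernel\<close>

text \<open>A linear substitute for the bearing Jacobian: it projects along the fixed directions
  \<open>gs\<close> and drops the division by edge lengths. It runs over both ordered pairs of each
  edge.\<close>

definition projected_edges ::
    "('n \<times> 'n) set \<Rightarrow> ('n \<Rightarrow> 'n \<Rightarrow> real^'d) \<Rightarrow> ('d::finite, 'n::finite) config \<Rightarrow> real^'d^('n \<times> 'n)" where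
  "projected_edges E gs x =
    (\<chi> e. if e \<in> E then orth_proj (gs (fst e) (snd e)) *v (x $ snd e - x $ fst e) else 0)"

lemma linear_projected_edges: "linear (projected_edges E gs)"
  by (rule linearI)
     (auto simp: projected_edges_def vec_eq_iff[where 'a="real^'d"] algebra_simps matrix_vector_right_distrib
       matrix_vector_mult_diff_distrib matrix_vector_mult_scaleR)

lemma norm_projected_edges:
  "(norm (projected_edges E gs x))\<^sup>2 =
     (\<Sum>(i, j)\<in>E. (norm (orth_proj (gs i j) *v (x $ j - x $ i)))\<^sup>2)"
proof -
  have "(norm (projected_edges E gs x))\<^sup>2 = (\<Sum>e\<in>UNIV. if e \<in> E then
     (norm (orth_proj (gs (fst e) (snd e)) *v (x $ snd e - x $ fst e)))\<^sup>2 else 0)"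
    unfolding power2_norm_eq_inner inner_vec_def[where 'a="real^'d"]
    by (intro sum.cong) (auto simp: projected_edges_def)
  also have "\<dots> = (\<Sum>(i, j)\<in>E. (norm (orth_proj (gs i j) *v (x $ j - x $ i)))\<^sup>2)"
    by (simp add: sum.If_cases split_def)
  finally show ?thesis .
qed

lemma projected_edges_vec [simp]: "projected_edges E gs (vec c) = 0"
  by (simp add: projected_edges_def vec_eq_iff)

lemma edge_of_satisfies_constraints:
  assumes "satisfies_constraints E gs q" "(i, j) \<in> E"
  shows "q $ j - q $ i = norm (q $ j - q $ i) *\<^sub>R gs i j" "norm (q $ j - q $ i) > 0"
proof -
  have ne: "q $ j - q $ i \<noteq> 0" and "bearing q i j = gs i j"
    using assms by (fastforce simp: satisfies_constraints_def noncolliding_def)+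
  then show "q $ j - q $ i = norm (q $ j - q $ i) *\<^sub>R gs i j"
    by (simp add: bearing_def flip: \<open>bearing q i j = gs i j\<close>)
  show "norm (q $ j - q $ i) > 0" using ne by simp
qed

lemma projected_edges_satisfies:
  assumes "bearing_constraints E gs" "satisfies_constraints E gs q"
  shows "projected_edges E gs q = 0"
proof -
  have "orth_proj (gs i j) *v (q $ j - q $ i) = 0" if e: "(i, j) \<in> E" for i j
  proof -
    have n: "norm (gs i j) = 1" using assms(1) e by (auto simp: bearing_constraints_def)
    have "orth_proj (gs i j) *v gs i j = 0"
      using n by (simp add: orth_proj_mult_unit dot_square_norm)
    then show ?thesis
      by (subst edge_of_satisfies_constraints(1)[OF assms(2) e])
         (simp only: matrix_vector_mult_scaleR scaleR_zero_right)
  qed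
  then show ?thesis by (auto simp: projected_edges_def vec_eq_iff[where 'a="real^'d"])
qed

text \<open>Projections ignore nonzero scaling of the direction, so at \<open>q\<close> each
  Jacobian block is a block of \<open>projected_edges\<close> divided by an edge length. Vanishing
  of the latter thus puts \<open>x\<close> in the Jacobian kernel, where rigidity applies.\<close>

lemma projected_edges_eq_0_imp:
  fixes q :: "('d::finite, 'n::finite) config"
  assumes "infinitesimally_bearing_rigid E q" "satisfies_constraints E gs q"
    and "bearing_constraints E gs" "projected_edges E gs x = 0"
  shows "\<exists>c \<alpha>. x = vec c + \<alpha> *\<^sub>R q"
proof -
  obtain A where A: "orientation E A" and
    rigid: "\<And>dq. frechet_derivative (stacked_bearing A) (at q) dq = 0 \<Longrightarrow> \<exists>c \<alpha>. dq = vec c + \<alpha> *\<^sub>R q"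
    using assms(1) unfolding infinitesimally_bearing_rigid_def by auto
  have AE: "A \<subseteq> E" using A by (auto simp: orientation_def)
  have ne: "q $ i \<noteq> q $ j" if "(i, j) \<in> A" for i j
    using assms(2) AE that by (auto simp: satisfies_constraints_def noncolliding_def)
  have D: "frechet_derivative (stacked_bearing A) (at q) = (\<lambda>h. \<chi> e. if e \<in> A then
    (orth_proj (q $ snd e - q $ fst e) *v (h $ snd e - h $ fst e)) /\<^sub>R norm (q $ snd e - q $ fst e) else 0)"
    by (rule frechet_derivative_at[symmetric] has_derivative_stacked_bearing)+ (rule ne)
  have "orth_proj (q $ j - q $ i) *v (x $ j - x $ i) = 0" if "(i, j) \<in> A" for i j
  proof -
    have e: "(i, j) \<in> E" using that AE by auto
    define l where "l = norm (q $ j - q $ i)"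
    have l: "l > 0" and ql: "q $ j - q $ i = l *\<^sub>R gs i j"
      using edge_of_satisfies_constraints[OF assms(2) e] by (auto simp: l_def)
    have n: "norm (gs i j) = 1" using assms(3) e by (auto simp: bearing_constraints_def)
    have "orth_proj (l *\<^sub>R gs i j) *v (x $ j - x $ i) = orth_proj (gs i j) *v (x $ j - x $ i)"
      unfolding orth_proj_mult using l n by (simp add: power2_eq_square)
    also have "\<dots> = projected_edges E gs x $ (i, j)"
      using e by (simp add: projected_edges_def)
    finally show ?thesis using assms(4) ql by simp
  qed
  then have "frechet_derivative (stacked_bearing A) (at q) x = 0"
    by (auto simp: D vec_eq_iff[where 'a="real^'d"])
  then show ?thesis by (rule rigid)
qed

section \<open>Centroid, translations and coercivity\<close>

lemma vec_inner: "vec c \<bullet> (x :: ('d::finite, 'n::finite) config) = c \<bullet> (\<Sum>i\<in>UNIV. x $ i)"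
  by (simp add: inner_vec_def[where 'a="real^'d"] inner_sum_right)

lemma vec_inner_centroid:
  fixes x :: "('d::finite, 'n::finite) config"
  shows "vec c \<bullet> x = real CARD('n) * (c \<bullet> centroid x)"
  by (simp add: vec_inner centroid_def)

lemma centroid_vec [simp]: "centroid (vec c :: ('d::finite, 'n::finite) config) = c"
  by (simp add: centroid_def sum_constant_scaleR del: sum_constant)

lemma vec_centroid_orthogonal:
  fixes x :: "('d::finite, 'n::finite) config"
  shows "vec c \<bullet> (x - vec (centroid x)) = 0"
  by (simp add: inner_diff_right vec_inner_centroid)

text \<open>The map is injective on the orthogonal complement of the translations and the centered
  \<open>q\<close>, and an injective linear map on a finite-dimensional space is bounded
  below.\<close>

lemma projected_edges_bounded_below:
  fixes q :: "('d::finite, 'n::finite) config"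
  assumes "infinitesimally_bearing_rigid E q" "satisfies_constraints E gs q"
    and "bearing_constraints E gs"
  shows "\<exists>\<epsilon>>0. \<forall>w. (\<forall>c. vec c \<bullet> w = 0) \<longrightarrow> (q - vec (centroid q)) \<bullet> w = 0 \<longrightarrow>
    \<epsilon> * norm w \<le> norm (projected_edges E gs w)"
proof -
  define W where "W = {w. (\<forall>c. vec c \<bullet> w = 0) \<and> (q - vec (centroid q)) \<bullet> w = 0}"
  have sub: "subspace W"
    by (auto simp: W_def subspace_def inner_add_right)
  have "\<exists>\<epsilon>>0. \<forall>w\<in>W. norm (projected_edges E gs w) \<ge> \<epsilon> * norm w"
  proof (rule injective_imp_isometric[OF closed_subspace[OF sub] sub])
    show "bounded_linear (projected_edges E gs)"
      using linear_projected_edges by (simp add: linear_conv_bounded_linear)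
    show "\<forall>w\<in>W. projected_edges E gs w = 0 \<longrightarrow> w = 0"
    proof (intro ballI impI)
      fix w assume w: "w \<in> W" "projected_edges E gs w = 0"
      obtain c \<alpha> where eq: "w = vec c + \<alpha> *\<^sub>R q"
        using projected_edges_eq_0_imp[OF assms w(2)] by blast
      \<comment> \<open>Regrouping around the centroid writes \<open>w\<close> as a combination of
        vectors orthogonal to it.\<close>
      then have "w = vec (c + \<alpha> *\<^sub>R centroid q) + \<alpha> *\<^sub>R (q - vec (centroid q))"
        by (simp add: vec_eq_iff algebra_simps)
      then have "w \<bullet> w = (vec (c + \<alpha> *\<^sub>R centroid q) + \<alpha> *\<^sub>R (q - vec (centroid q))) \<bullet> w"
        by simp
      also have "\<dots> = 0" using w(1) unfolding W_def inner_add_left inner_scaleR_left by simp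
      finally show "w = 0" by simp
    qed
  qed
  then show ?thesis by (auto simp: W_def)
qed

lemma scale_eq_norm:
  fixes x :: "('d::finite, 'n::finite) config"
  shows "scale x = norm (x - vec (centroid x)) / sqrt (real CARD('n))"
  by (simp add: scale_def norm_vec_def[where 'a="real^'d"] L2_set_def real_sqrt_divide)

section \<open>Edge sums and the velocity field\<close>

text \<open>Summation by parts on the graph: reversing edges permutes \<open>E\<close> and negates
  \<open>w\<close>. The half appears because each undirected edge is counted twice.\<close>

lemma sum_inner_neighbors:
  fixes x :: "('d::finite, 'n::finite) config"
  assumes "sym E" "\<And>i j. (i, j) \<in> E \<Longrightarrow> w j i = - w i j"
  shows "(\<Sum>i\<in>UNIV. x $ i \<bullet> (- (\<Sum>j\<in>neighbors E i. w i j))) = (\<Sum>(i, j)\<in>E. (x $ j - x $ i) \<bullet> w i j) / 2"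
proof -
  have "(\<Sum>i\<in>UNIV. x $ i \<bullet> (\<Sum>j\<in>neighbors E i. w i j)) = (\<Sum>i\<in>UNIV. \<Sum>j\<in>neighbors E i. x $ i \<bullet> w i j)"
    by (simp add: inner_sum_right)
  also have "\<dots> = (\<Sum>(i, j)\<in>Sigma UNIV (neighbors E). x $ i \<bullet> w i j)"
    by (rule sum.Sigma) auto
  also have "Sigma UNIV (neighbors E) = E" by (auto simp: neighbors_def)
  finally have 1: "(\<Sum>i\<in>UNIV. x $ i \<bullet> (\<Sum>j\<in>neighbors E i. w i j)) = (\<Sum>(i, j)\<in>E. x $ i \<bullet> w i j)" .
  have "(\<Sum>(i, j)\<in>E. x $ i \<bullet> w i j) = (\<Sum>(i, j)\<in>E. x $ j \<bullet> w j i)"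
    by (rule sum.reindex_bij_witness[where i=prod.swap and j=prod.swap])
       (use assms(1) in \<open>auto dest: symD\<close>)
  also have "\<dots> = (\<Sum>(i, j)\<in>E. - (x $ j \<bullet> w i j))"
    using assms(2) by (intro sum.cong) auto
  finally have 2: "(\<Sum>(i, j)\<in>E. x $ i \<bullet> w i j) = - (\<Sum>(i, j)\<in>E. x $ j \<bullet> w i j)"
    by (simp add: split_def sum_negf)
  have "(\<Sum>(i, j)\<in>E. (x $ j - x $ i) \<bullet> w i j) = (\<Sum>(i, j)\<in>E. x $ j \<bullet> w i j) - (\<Sum>(i, j)\<in>E. x $ i \<bullet> w i j)"
    by (simp add: split_def inner_diff_left sum_subtractf)
  with 1 2 show ?thesis by (simp add: sum_negf)
qed

lemma one_minus_inner_bearing: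
  assumes "norm v = 1" "y \<noteq> 0"
  shows "1 - ((y /\<^sub>R norm y) \<bullet> v)\<^sup>2 = (norm (orth_proj v *v y))\<^sup>2 / (norm y)\<^sup>2"
  using assms(2) by (simp add: norm_orth_proj_unit[OF assms(1)] diff_divide_distrib power_mult_distrib
      power_inverse divide_inverse_commute right_diff_distrib inner_commute)

definition bearing_only_field ::
    "('n \<times> 'n) set \<Rightarrow> ('n \<Rightarrow> 'n \<Rightarrow> real^'d) \<Rightarrow> ('d::finite, 'n::finite) config \<Rightarrow> ('d, 'n) config" where
  "bearing_only_field E gs q = (\<chi> i. - (\<Sum>j\<in>neighbors E i. orth_proj (bearing q i j) *v gs i j))"

lemma bearing_only_solution_field:
  assumes "bearing_only_solution E gs p" "t \<ge> 0"
  shows "(p has_vector_derivative bearing_only_field E gs (p t)) (at t within {0..})"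
proof -
  have "((\<lambda>\<tau>. p \<tau> $ i) has_vector_derivative bearing_only_field E gs (p t) $ i) (at t within {0..})" for i
    using assms by (simp add: bearing_only_solution_def bearing_only_field_def)
  then have "((\<lambda>\<tau>. \<chi> i. p \<tau> $ i) has_derivative (\<lambda>h. \<chi> i. h *\<^sub>R bearing_only_field E gs (p t) $ i)) (at t within {0..})"
    unfolding has_vector_derivative_def by (intro has_derivative_vec_lambda)
  then show ?thesis
    by (simp add: has_vector_derivative_def flip: vector_scaleR_component)
qed

lemma inner_bearing_only_field:
  assumes "undirected_graph E" "bearing_constraints E gs"
  shows "x \<bullet> bearing_only_field E gs q =
    (\<Sum>(i, j)\<in>E. (x $ j - x $ i) \<bullet> (orth_proj (bearing q i j) *v gs i j)) / 2"
proof -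
  \<comment> \<open>Reversal negates the bearing, which leaves the projection unchanged, and negates
    the constraint.\<close>
  have "orth_proj (bearing q j i) *v gs j i = - (orth_proj (bearing q i j) *v gs i j)" if "(i, j) \<in> E" for i j
  proof -
    have "bearing q j i = - bearing q i j" by (simp add: bearing_def norm_minus_commute algebra_simps)
    moreover have "gs i j = - gs j i" using assms(2) that by (auto simp: bearing_constraints_def)
    ultimately show ?thesis by (simp add: orth_proj_mult)
  qed
  moreover have "sym E" using assms(1) by (simp add: undirected_graph_def)
  ultimately show ?thesis
    by (subst sum_inner_neighbors[symmetric])
       (simp_all add: inner_vec_def[where 'a="real^'d"] bearing_only_field_def)
qed

lemma vec_inner_bearing_only_field:
  assumes "undirected_graph E" "bearing_constraints E gs"
  shows "vec c \<bullet> bearing_only_field E gs q = 0"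
  by (simp add: inner_bearing_only_field[OF assms])

text \<open>Each edge vector is orthogonal to the range of its own projection; a zero edge
  contributes nothing.\<close>

lemma self_inner_bearing_only_field:
  fixes q :: "('d::finite, 'n::finite) config"
  assumes "undirected_graph E" "bearing_constraints E gs"
  shows "q \<bullet> bearing_only_field E gs q = 0"
proof -
  have "(y :: real^'d) \<bullet> (orth_proj (y /\<^sub>R norm y) *v v) = 0" for y v :: "real^'d"
    by (cases "y = 0")
       (simp_all add: orth_proj_mult inner_diff_right dot_square_norm power2_eq_square field_simps)
  then show ?thesis by (simp add: inner_bearing_only_field[OF assms] bearing_def)
qed

text \<open>The dissipation estimate. Edges of \<open>x\<close> point along \<open>gs\<close>, so
  each term is an edge length of \<open>x\<close> times a squared sine, and that sine is the
  projected edge of \<open>q\<close> over its length. The bounds \<open>m\<close> and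
  \<open>M\<close> make the factor uniform over edges.\<close>

lemma target_inner_bearing_only_field:
  fixes q x :: "('d::finite, 'n::finite) config"
  assumes "undirected_graph E" "bearing_constraints E gs"
    and x: "satisfies_constraints E gs x" and q: "noncolliding E q"
    and m: "m \<ge> 0" "\<And>i j. (i, j) \<in> E \<Longrightarrow> m \<le> norm (x $ j - x $ i)"
    and M: "\<And>i j. (i, j) \<in> E \<Longrightarrow> norm (q $ j - q $ i) \<le> M"
  shows "2 * (x \<bullet> bearing_only_field E gs q) \<ge> m / M\<^sup>2 * (norm (projected_edges E gs q))\<^sup>2"
proof -
  have "m / M\<^sup>2 * (norm (orth_proj (gs i j) *v (q $ j - q $ i)))\<^sup>2
      \<le> (x $ j - x $ i) \<bullet> (orth_proj (bearing q i j) *v gs i j)" if e: "(i, j) \<in> E" for i j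
  proof -
    define y where "y = q $ j - q $ i"
    have y: "y \<noteq> 0" using q e by (auto simp: noncolliding_def y_def)
    have b: "bearing q i j = y /\<^sub>R norm y" by (simp add: bearing_def y_def)
    have n: "norm (gs i j) = 1" using assms(2) e by (auto simp: bearing_constraints_def)
    have "M > 0" using M[OF e] y by (auto simp: y_def intro: less_le_trans[rotated])
    let ?N = "(norm (orth_proj (gs i j) *v y))\<^sup>2"
    have "m / M\<^sup>2 * ?N = m * (?N / M\<^sup>2)" by simp
    also have "\<dots> \<le> norm (x $ j - x $ i) * (?N / (norm y)\<^sup>2)"
      using m e M[OF e] y \<open>M > 0\<close> by (intro mult_mono divide_left_mono power_mono) (auto simp: y_def)
    also have "?N / (norm y)\<^sup>2 = gs i j \<bullet> (orth_proj (bearing q i j) *v gs i j)"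
      using y n by (subst b, subst inner_orth_proj_unit) (simp_all add: one_minus_inner_bearing del: inner_scaleR_left)
    also have "norm (x $ j - x $ i) * \<dots> = (x $ j - x $ i) \<bullet> (orth_proj (bearing q i j) *v gs i j)"
      using edge_of_satisfies_constraints(1)[OF x e] by (metis inner_scaleR_left)
    finally show ?thesis by (simp add: y_def)
  qed
  then have "m / M\<^sup>2 * (norm (projected_edges E gs q))\<^sup>2 \<le>
     (\<Sum>(i, j)\<in>E. (x $ j - x $ i) \<bullet> (orth_proj (bearing q i j) *v gs i j))"
    unfolding norm_projected_edges sum_distrib_left by (intro sum_mono) auto
  then show ?thesis by (simp add: inner_bearing_only_field[OF assms(1,2)])
qed

section \<open>Consequences of differential inequalities\<close>

text \<open>Gronwall's argument: the integrating factor \<open>exp (K * t)\<close> turns the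
  inequality into monotonicity. The sign of \<open>K\<close> is arbitrary.\<close>

lemma exponential_decay:
  fixes f :: "real \<Rightarrow> real"
  assumes "\<And>t. t \<ge> 0 \<Longrightarrow> (f has_real_derivative f' t) (at t within {0..})"
    and "\<And>t. t > 0 \<Longrightarrow> f' t \<le> - K * f t" and "t \<ge> 0"
  shows "f t \<le> f 0 * exp (- K * t)"
proof -
  define h where "h = (\<lambda>t. f t * exp (K * t))"
  have h': "(h has_real_derivative (f' s + K * f s) * exp (K * s)) (at s within {0..})" if "s \<ge> 0" for s
    unfolding h_def using assms(1)[OF that]
    by (auto intro!: derivative_eq_intros simp: algebra_simps)
  have "h t \<le> h 0"
  proof (rule DERIV_nonpos_imp_decreasing_open[OF assms(3)])
    fix s assume "0 < s" "s < t"
    then have "(h has_real_derivative (f' s + K * f s) * exp (K * s)) (at s)"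
      using h'[of s] at_within_interior[of s "{0..}"] by simp
    moreover have "(f' s + K * f s) * exp (K * s) \<le> 0"
      using assms(2)[OF \<open>0 < s\<close>] by (intro mult_nonpos_nonneg) auto
    ultimately show "\<exists>y. DERIV h s :> y \<and> y \<le> 0" by blast
  next
    show "continuous_on {0..t} h"
      by (rule continuous_on_subset[of "{0..}"], rule DERIV_continuous_on[OF h']) auto
  qed
  then have "f t * exp (K * t) * exp (- K * t) \<le> f 0 * exp (- K * t)"
    by (intro mult_right_mono) (auto simp: h_def)
  then show ?thesis by (simp add: mult.assoc flip: exp_add)
qed

lemma constant_of_zero_derivative:
  fixes f :: "real \<Rightarrow> real"
  assumes "\<And>t. t \<ge> 0 \<Longrightarrow> (f has_real_derivative 0) (at t within {0..})" and "t \<ge> 0"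
  shows "f t = f 0"
  using has_field_derivative_zero_constant[of "{0..}" f] assms by (metis atLeast_iff convex_real_interval(1) order_refl)

text \<open>Only the part of \<open>d\<close> orthogonal to \<open>r\<close> is seen by \<open>projected_edges\<close>.\<close>

lemma projected_edges_sphere_bound:
  fixes d r :: "('d::finite, 'n::finite) config"
  assumes "\<epsilon> > 0"
    and bd: "\<And>w. (\<And>c. vec c \<bullet> w = 0) \<Longrightarrow> r \<bullet> w = 0 \<Longrightarrow> \<epsilon> * norm w \<le> norm (projected_edges E gs w)"
    and r: "r \<noteq> 0" "projected_edges E gs r = 0" "\<And>c. vec c \<bullet> r = 0"
    and d: "\<And>c. vec c \<bullet> d = 0" "norm (d + r) = norm r"
  shows "\<epsilon>\<^sup>2 * ((norm d)\<^sup>2 * (1 - (norm d)\<^sup>2 / (4 * (norm r)\<^sup>2))) \<le> (norm (projected_edges E gs d))\<^sup>2"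
proof -
  define a where "a = (r \<bullet> d) / (r \<bullet> r)"
  define w where "w = d - a *\<^sub>R r"
  have rr: "r \<bullet> r > 0" using r(1) by simp
  have rw: "r \<bullet> w = 0" using rr by (simp add: w_def a_def inner_diff_right)
  have L: "projected_edges E gs w = projected_edges E gs d"
    using r(2) by (simp add: w_def linear_diff[OF linear_projected_edges] linear_scale[OF linear_projected_edges])
  \<comment> \<open>Expanding the square leaves
    \<open>2 * (r \<bullet> d) + d \<bullet> d = 0\<close>, so the component of \<open>d\<close>
    along \<open>r\<close> depends on \<open>d\<close> only through its norm.\<close>
  have "(norm (d + r))\<^sup>2 = (norm r)\<^sup>2" using d(2) by simp
  then have rd: "r \<bullet> d = - (d \<bullet> d) / 2"
    by (simp add: power2_norm_eq_inner inner_add_left inner_add_right inner_commute)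
  have "(norm w)\<^sup>2 = d \<bullet> d - a * (r \<bullet> d)"
  proof -
    have "(norm w)\<^sup>2 = w \<bullet> d"
      using rw by (simp add: power2_norm_eq_inner) (simp add: w_def inner_diff_right inner_commute)
    then show ?thesis by (simp add: w_def inner_diff_left)
  qed
  also have "\<dots> = d \<bullet> d * (1 - d \<bullet> d / (4 * (r \<bullet> r)))"
    by (simp add: a_def rd algebra_simps)
  finally have nw: "(norm w)\<^sup>2 = (norm d)\<^sup>2 * (1 - (norm d)\<^sup>2 / (4 * (norm r)\<^sup>2))"
    by (simp add: power2_norm_eq_inner)
  have "vec c \<bullet> w = 0" for c using d(1) r(3) by (simp add: w_def inner_diff_right)
  then have "\<epsilon> * norm w \<le> norm (projected_edges E gs d)" using bd[of w] rw L by simp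
  then have "(\<epsilon> * norm w)\<^sup>2 \<le> (norm (projected_edges E gs d))\<^sup>2"
    using assms(1) by (intro power_mono) auto
  then show ?thesis by (simp add: power_mult_distrib nw)
qed

section \<open>Lyapunov argument for the squared distance to the target\<close>

theorem theorem11:
  fixes E :: "('n::finite \<times> 'n) set"
    and gs :: "'n \<Rightarrow> 'n \<Rightarrow> real^'d::finite"
    and p :: "real \<Rightarrow> ('d, 'n) config"
    and ps rs :: "('d, 'n) config"
  assumes "CARD('n) \<ge> 2" and "CARD('d) \<ge> 2"
    and "undirected_graph E"
    and "bearing_constraints E gs" and "feasible E gs" and "ensures_rigidity E gs"
    and "noncolliding E (p 0)"
    and "target_configuration E gs (p 0) ps"
    and "rs = ps - vec (centroid ps)"
    and "bearing_only_solution E gs p"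
    and "\<forall>t\<ge>0. noncolliding E (p t)"
    and "p 0 - ps \<noteq> - 2 *\<^sub>R rs"
  shows "\<exists>C>0. \<exists>K>0. \<forall>t\<ge>0. norm (p t - ps) \<le> C * exp (- K * t)"
proof -
  note graph = assms(3,4)
  let ?F = "bearing_only_field E gs" and ?L = "projected_edges E gs"
  define \<delta> where "\<delta> = (\<lambda>t. p t - ps)"
  have cen: "centroid ps = centroid (p 0)" and sc: "scale ps = scale (p 0)"
    and sat: "satisfies_constraints E gs ps"
    using assms(8) by (auto simp: target_configuration_def)
  have p': "(p has_vector_derivative ?F (p t)) (at t within {0..})" if "t \<ge> 0" for t
    using bearing_only_solution_field[OF assms(10) that] .
  have inner': "((\<lambda>t. x \<bullet> p t) has_real_derivative x \<bullet> ?F (p t)) (at t within {0..})" if "t \<ge> 0" for x t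
    using bounded_linear.has_vector_derivative[OF bounded_linear_inner_right p'[OF that], of x]
    by (simp add: has_real_derivative_iff_has_vector_derivative)
  have norm': "((\<lambda>t. p t \<bullet> p t) has_real_derivative 0) (at t within {0..})" if "t \<ge> 0" for t
    using bounded_bilinear.has_vector_derivative[OF bounded_bilinear_inner p'[OF that] p'[OF that]]
      self_inner_bearing_only_field[OF graph, of "p t"]
    by (simp add: has_real_derivative_iff_has_vector_derivative inner_commute)
  have pp: "p t \<bullet> p t = p 0 \<bullet> p 0" if "t \<ge> 0" for t
    using constant_of_zero_derivative[OF norm' that] .
  have vp: "vec c \<bullet> p t = vec c \<bullet> p 0" if "t \<ge> 0" for t c
    using constant_of_zero_derivative[OF _ that, of "\<lambda>t. vec c \<bullet> p t"]
      inner'[of _ "vec c"] vec_inner_bearing_only_field[OF graph] by simp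
  have vd: "vec c \<bullet> \<delta> t = 0" if "t \<ge> 0" for t c
    by (simp add: \<delta>_def inner_diff_right vp[OF that]) (simp add: vec_inner_centroid cen)
  have sphere: "norm (\<delta> t + rs) = norm rs" if "t \<ge> 0" for t
  proof -
    \<comment> \<open>Equal centroids make \<open>\<delta> t + rs\<close> the centered
      \<open>p t\<close>. Its norm is conserved, and equality of scales identifies the initial value
      with \<open>norm rs\<close>.\<close>
    have "\<delta> t + rs = p t - vec (centroid (p 0))" by (simp add: \<delta>_def assms(9) cen)
    moreover have "(norm (p t - vec (centroid (p 0))))\<^sup>2 = (norm (p 0 - vec (centroid (p 0))))\<^sup>2"
      using vp[OF that, of "centroid (p 0)"] pp[OF that]
      by (simp add: power2_norm_eq_inner inner_diff_left inner_diff_right inner_commute)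
    moreover have "norm rs = norm (p 0 - vec (centroid (p 0)))"
      using sc by (simp add: scale_eq_norm assms(9))
    ultimately show ?thesis by simp
  qed
  have "rs \<noteq> 0"
  proof
    \<comment> \<open>The sphere would shrink to a point, giving
      \<open>\<delta> 0 = 0 = - 2 *\<^sub>R rs\<close>, the excluded case.\<close>
    assume "rs = 0"
    then show False using sphere[of 0] assms(12) by (simp add: \<delta>_def)
  qed
  have Lps: "?L ps = 0" by (rule projected_edges_satisfies[OF assms(4) sat])
  have Lrs: "?L rs = 0"
    by (simp add: assms(9) linear_diff[OF linear_projected_edges] Lps)
  have vrs: "vec c \<bullet> rs = 0" for c
    unfolding assms(9) by (rule vec_centroid_orthogonal)
  have Ld: "?L (\<delta> t) = ?L (p t)" for t
    by (simp add: \<delta>_def linear_diff[OF linear_projected_edges] Lps)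
  have "infinitesimally_bearing_rigid E ps"
    using assms(6) sat by (simp add: ensures_rigidity_def)
  then obtain \<epsilon> where \<epsilon>: "\<epsilon> > 0"
    "\<And>w. (\<And>c. vec c \<bullet> w = 0) \<Longrightarrow> rs \<bullet> w = 0 \<Longrightarrow> \<epsilon> * norm w \<le> norm (?L w)"
    using projected_edges_bounded_below[OF _ sat assms(4)] unfolding assms(9) by blast
  obtain m where m: "m > 0" "\<And>i j. (i, j) \<in> E \<Longrightarrow> m \<le> norm (ps $ j - ps $ i)"
  proof
    \<comment> \<open>Inserting 1 keeps the minimum defined for an edgeless graph.\<close>
    let ?S = "insert 1 ((\<lambda>(i, j). norm (ps $ j - ps $ i)) ` E)"
    show "Min ?S > 0"
      using edge_of_satisfies_constraints(2)[OF sat] by (subst Min_gr_iff) auto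
    show "Min ?S \<le> norm (ps $ j - ps $ i)" if "(i, j) \<in> E" for i j
      using that by (intro Min_le) (auto intro!: rev_image_eqI)
  qed
  \<comment> \<open>Twice the conserved norm bounds every edge length; adding 1 ensures
    positivity.\<close>
  define M where "M = 2 * norm (p 0) + 1"
  have "M > 0" by (simp add: M_def add_nonneg_pos)
  have M: "norm (p t $ j - p t $ i) \<le> M" if "t \<ge> 0" for t i j
  proof -
    have "norm (p t $ j - p t $ i) \<le> norm (p t $ j) + norm (p t $ i)" by (rule norm_triangle_ineq4)
    also have "\<dots> \<le> 2 * norm (p t)" 
      using Finite_Cartesian_Product.norm_nth_le[of "p t" i] Finite_Cartesian_Product.norm_nth_le[of "p t" j] by simp
    also have "norm (p t) = norm (p 0)" using pp[OF that] by (simp add: norm_eq)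
    finally show ?thesis by (simp add: M_def)
  qed
  define V where "V = (\<lambda>t. (norm (\<delta> t))\<^sup>2)"
  have V': "(V has_real_derivative - 2 * (ps \<bullet> ?F (p t))) (at t within {0..})" if "t \<ge> 0" for t
  proof -
    \<comment> \<open>Since \<open>p t \<bullet> p t\<close> has zero derivative, only the cross
      term contributes to the derivative of \<open>V\<close>.\<close>
    have "V = (\<lambda>t. p t \<bullet> p t - 2 * (ps \<bullet> p t) + ps \<bullet> ps)"
      by (simp add: fun_eq_iff V_def \<delta>_def power2_norm_eq_inner inner_diff_left inner_diff_right inner_commute)
    then show ?thesis
      using norm'[OF that] inner'[OF that, of ps] by (auto intro!: derivative_eq_intros)
  qed
  have V'_le: "- 2 * (ps \<bullet> ?F (p t)) \<le> - (m / M\<^sup>2) * (norm (?L (\<delta> t)))\<^sup>2" if "t \<ge> 0" for t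
  proof -
    have "2 * (ps \<bullet> ?F (p t)) \<ge> m / M\<^sup>2 * (norm (?L (p t)))\<^sup>2"
      using target_inner_bearing_only_field[OF graph sat, of "p t" m M] assms(11) that m M by auto
    then show ?thesis by (simp add: Ld)
  qed
  have V_le: "V t \<le> V 0" if "t \<ge> 0" for t
  proof -
    \<comment> \<open>Rate 0 in \<open>exponential_decay\<close> yields monotonicity.\<close>
    have "- 2 * (ps \<bullet> ?F (p s)) \<le> - 0 * V s" if "s > 0" for s
    proof -
      have "0 \<le> m / M\<^sup>2 * (norm (?L (\<delta> s)))\<^sup>2" using m(1) by simp
      then show ?thesis using V'_le[of s] that by simp
    qed
    then show ?thesis using exponential_decay[OF V' _ that, of 0] by simp
  qed
  define \<kappa> where "\<kappa> = 1 - V 0 / (4 * (norm rs)\<^sup>2)"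
  have "\<kappa> > 0"
  proof -
    \<comment> \<open>The parallelogram law for \<open>\<delta> 0 + rs\<close> and
      \<open>rs\<close>: the distance to the antipode \<open>- 2 *\<^sub>R rs\<close> measures how
      far \<open>V 0\<close> stays below its maximum on the sphere.\<close>
    have "(norm (\<delta> 0 + 2 *\<^sub>R rs))\<^sup>2 + V 0 = 2 * (norm (\<delta> 0 + rs))\<^sup>2 + 2 * (norm rs)\<^sup>2"
      by (simp add: V_def power2_norm_eq_inner inner_add_left inner_add_right inner_commute)
    also have "\<dots> = 4 * (norm rs)\<^sup>2" by (simp add: sphere)
    finally have "(norm (\<delta> 0 + 2 *\<^sub>R rs))\<^sup>2 + V 0 = 4 * (norm rs)\<^sup>2" .
    moreover have "\<delta> 0 + 2 *\<^sub>R rs \<noteq> 0"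
      using assms(12) by (simp add: \<delta>_def add_eq_0_iff2)
    ultimately have "V 0 < 4 * (norm rs)\<^sup>2"
      by (smt (verit) zero_less_norm_iff zero_less_power)
    then show ?thesis using \<open>rs \<noteq> 0\<close> by (simp add: \<kappa>_def)
  qed
  define K where "K = m / M\<^sup>2 * (\<epsilon>\<^sup>2 * \<kappa>)"
  have "K > 0" using m(1) \<open>M > 0\<close> \<epsilon>(1) \<open>\<kappa> > 0\<close> by (simp add: K_def)
  have decay: "- 2 * (ps \<bullet> ?F (p t)) \<le> - K * V t" if "t > 0" for t
  proof -
    have t: "t \<ge> 0" using that by simp
    \<comment> \<open>Monotonicity of \<open>V\<close> replaces the time-dependent factor by the
      constant \<open>\<kappa>\<close>.\<close>
    have "\<epsilon>\<^sup>2 * (V t * \<kappa>) \<le> \<epsilon>\<^sup>2 * (V t * (1 - V t / (4 * (norm rs)\<^sup>2)))"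
      using V_le[OF t] by (intro mult_left_mono) (auto simp: \<kappa>_def V_def intro!: divide_right_mono)
    also have "\<dots> \<le> (norm (?L (\<delta> t)))\<^sup>2"
      unfolding V_def
      by (rule projected_edges_sphere_bound[OF \<epsilon> \<open>rs \<noteq> 0\<close> Lrs vrs vd[OF t] sphere[OF t]])
    finally have "m / M\<^sup>2 * (\<epsilon>\<^sup>2 * (V t * \<kappa>)) \<le> m / M\<^sup>2 * (norm (?L (\<delta> t)))\<^sup>2"
      using m(1) by (intro mult_left_mono) auto
    then show ?thesis using V'_le[OF t] by (simp add: K_def algebra_simps)
  qed
  \<comment> \<open>The rate is halved because \<open>V\<close> is a squared norm; the added 1 keeps
    the constant positive when \<open>\<delta> 0 = 0\<close>.\<close>
  have "norm (p t - ps) \<le> (norm (\<delta> 0) + 1) * exp (- (K / 2) * t)" if "t \<ge> 0" for t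
  proof -
    have "(norm (\<delta> t))\<^sup>2 \<le> (norm (\<delta> 0))\<^sup>2 * exp (- K * t)"
      using exponential_decay[OF V' decay that] by (simp add: V_def)
    also have "\<dots> = (norm (\<delta> 0) * exp (- (K / 2) * t))\<^sup>2"
      by (simp add: power_mult_distrib flip: exp_double)
    finally have "norm (\<delta> t) \<le> norm (\<delta> 0) * exp (- (K / 2) * t)"
      by (rule power2_le_imp_le) simp
    also have "\<dots> \<le> (norm (\<delta> 0) + 1) * exp (- (K / 2) * t)" by (intro mult_right_mono) auto
    finally show ?thesis by (simp add: \<delta>_def)
  qed
  moreover have "norm (\<delta> 0) + 1 > 0" "K / 2 > 0"
    using \<open>K > 0\<close> by (auto intro: add_nonneg_pos)
  ultimately show ?thesis by blast
qed

end
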